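(* Let $\underline\alpha=(\alpha_1,\alpha_2,\alpha_3)\in\mathbb N^3$ (entries $\ge 0$), let $\alpha=\alpha_1+\alpha_2+\alpha_3$, and let $A_i=\mathbb C^{\alpha_i}$ for $i=1,2,3$. Define the quadratic map $F^{\underline\alpha}$ of $\mathbb C^3\oplus A_1\oplus A_2\oplus A_3=\mathbb C^{3+\alpha}$ by $$F^{\underline\alpha}(x_1,x_2,x_3,\boldsymbol a_1,\boldsymbol a_2,\boldsymbol a_3)=\big(x_2x_3,\,x_1x_3,\,x_1x_2,\,x_1\boldsymbol a_1,\,x_2\boldsymbol a_2,\,x_3\boldsymbol a_3\big),\qquad \boldsymbol a_i\in A_i.$$ Then $F^{\underline\alpha}(F^{\underline\alpha}(\boldsymbol x,\boldsymbol a))=x_1x_2x_3\,(\boldsymbol x,\boldsymbol a)$ for all $(\boldsymbol x,\boldsymbol a)$, and the projectivization $f^{\underline\alpha}=[F^{\underline\alpha}]$ is an involutive Cremona transformation of $\mathbb P^{2+\alpha}$ of bidegree $(2,2)$.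
   Context: A Cremona transformation of $\mathbb P^n$ (over $\mathbb C$) has bidegree $(2,2)$ if it is given by quadratic forms without common factor and its inverse is also given by quadratic forms without common factor. *)

theory Defs
  imports "Jordan_Normal_Form.Matrix" "HOL-Library.Poly_Mapping"
begin

section \<open>Polynomials over the complex numbers\<close>

text \<open>A polynomial is a finitely supported map from monomials to coefficients, a monomial a
  finitely supported map from variables to exponents; the library equips this type with its ring
  structure. The variables are indexed by \<open>nat\<close>, and the polynomials in the variables
  \<open>0, \<dots>, N - 1\<close> form the subring \<^term>\<open>poly_ring N\<close> defined below.\<close>

type_synonym cpoly = "(nat \<Rightarrow>\<^sub>0 nat) \<Rightarrow>\<^sub>0 complex"

definition poly_ring :: "nat \<Rightarrow> cpoly set" where
  "poly_ring N = {p. \<forall>m \<in> Poly_Mapping.keys p. Poly_Mapping.keys m \<subseteq> {..<N}}"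

definition const_poly :: "complex \<Rightarrow> cpoly" where
  "const_poly c = Poly_Mapping.single 0 c"

definition variable :: "nat \<Rightarrow> cpoly" where
  "variable i = Poly_Mapping.single (Poly_Mapping.single i 1) 1"

text \<open>The zero polynomial is a form of every degree.\<close>

definition is_form :: "nat \<Rightarrow> nat \<Rightarrow> cpoly \<Rightarrow> bool" where
  "is_form N d p \<longleftrightarrow> p \<in> poly_ring N \<and> (\<forall>m \<in> Poly_Mapping.keys p. (\<Sum>i \<in> Poly_Mapping.keys m. Poly_Mapping.lookup m i) = d)"

text \<open>Value of a polynomial at \<open>v\<close>, where \<open>c\<close> embeds the coefficients into the target ring.\<close>

definition poly_value :: "(complex \<Rightarrow> 'a) \<Rightarrow> 'a vec \<Rightarrow> cpoly \<Rightarrow> 'a::comm_ring_1" where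
  "poly_value c v p =
     (\<Sum>m \<in> Poly_Mapping.keys p. c (Poly_Mapping.lookup p m) * (\<Prod>i \<in> Poly_Mapping.keys m. (v $ i) ^ Poly_Mapping.lookup m i))"

definition eval_tuple :: "cpoly vec \<Rightarrow> complex vec \<Rightarrow> complex vec" where
  "eval_tuple P v = map_vec (poly_value (\<lambda>c. c) v) P"

text \<open>The composite \<open>P \<circ> Q\<close> of polynomial maps, obtained by substitution.\<close>

definition subst_tuple :: "cpoly vec \<Rightarrow> cpoly vec \<Rightarrow> cpoly vec" where
  "subst_tuple P Q = map_vec (poly_value const_poly Q) P"

definition no_common_factor :: "nat \<Rightarrow> cpoly vec \<Rightarrow> bool" where
  "no_common_factor N P \<longleftrightarrow>
     (\<forall>h \<in> poly_ring N. (\<forall>i < dim_vec P. h dvd P $ i) \<longrightarrow> h dvd 1)"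


section \<open>Rational self-maps of projective space\<close>

text \<open>Rational maps from \<open>n\<close>-dimensional projective space to itself are classes of nonzero
  tuples of \<open>n + 1\<close> forms of one common degree in \<open>n + 1\<close> homogeneous coordinates. Two tuples
  define the same map iff they are proportional over the function field.\<close>

definition form_tuples_deg :: "nat \<Rightarrow> nat \<Rightarrow> cpoly vec set" where
  "form_tuples_deg n d =
     {P \<in> carrier_vec (n + 1). (\<forall>i < n + 1. is_form (n + 1) d (P $ i)) \<and> P \<noteq> 0\<^sub>v (n + 1)}"

definition form_tuples :: "nat \<Rightarrow> cpoly vec set" where
  "form_tuples n = (\<Union>d. form_tuples_deg n d)"

definition same_map :: "nat \<Rightarrow> (cpoly vec \<times> cpoly vec) set" where
  "same_map n = {(P, Q). P \<in> form_tuples n \<and> Q \<in> form_tuples n \<and>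
     (\<forall>i < n + 1. \<forall>j < n + 1. P $ i * Q $ j = P $ j * Q $ i)}"

definition rational_maps :: "nat \<Rightarrow> cpoly vec set set" where
  "rational_maps n = form_tuples n // same_map n"

definition id_map :: "nat \<Rightarrow> cpoly vec set" where
  "id_map n = same_map n `` {vec (n + 1) variable}"

text \<open>The composite \<open>f \<circ> g\<close>. It is the empty set, hence not a rational map, if the image of \<open>g\<close>
  lies in the indeterminacy locus of \<open>f\<close>, that is, if every substitution vanishes identically.\<close>

definition compose_map :: "nat \<Rightarrow> cpoly vec set \<Rightarrow> cpoly vec set \<Rightarrow> cpoly vec set" where
  "compose_map n f g =
     (\<Union>P \<in> f. \<Union>Q \<in> g. {R. (subst_tuple P Q, R) \<in> same_map n})"

definition mutually_inverse :: "nat \<Rightarrow> cpoly vec set \<Rightarrow> cpoly vec set \<Rightarrow> bool" where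
  "mutually_inverse n f g \<longleftrightarrow>
     f \<in> rational_maps n \<and> g \<in> rational_maps n \<and>
     compose_map n f g = id_map n \<and> compose_map n g f = id_map n"

definition cremona :: "nat \<Rightarrow> cpoly vec set \<Rightarrow> bool" where
  "cremona n f \<longleftrightarrow> (\<exists>g. mutually_inverse n f g)"

definition involutive_map :: "nat \<Rightarrow> cpoly vec set \<Rightarrow> bool" where
  "involutive_map n f \<longleftrightarrow> compose_map n f f = id_map n"

definition given_by_coprime_forms :: "nat \<Rightarrow> nat \<Rightarrow> cpoly vec set \<Rightarrow> bool" where
  "given_by_coprime_forms n d f \<longleftrightarrow>
     (\<exists>P \<in> f. P \<in> form_tuples_deg n d \<and> no_common_factor (n + 1) P)"

definition has_bidegree :: "nat \<Rightarrow> cpoly vec set \<Rightarrow> nat \<Rightarrow> nat \<Rightarrow> bool" where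
  "has_bidegree n f d e \<longleftrightarrow> given_by_coprime_forms n d f \<and>
     (\<exists>g. mutually_inverse n f g \<and> given_by_coprime_forms n e g)"

text \<open>The rational map \<open>[F]\<close> defined by a map \<open>F\<close> of affine \<open>(n + 1)\<close>-space whose components are
  forms of one common degree, not all zero (the empty set for other \<open>F\<close>). As the ground field is
  infinite, \<open>P\<close> is uniquely determined by \<open>F\<close>.\<close>

definition projectivization :: "nat \<Rightarrow> (complex vec \<Rightarrow> complex vec) \<Rightarrow> cpoly vec set" where
  "projectivization n F =
     (\<Union>P \<in> {P \<in> form_tuples n. \<forall>v \<in> carrier_vec (n + 1). eval_tuple P v = F v}.
        same_map n `` {P})"


section \<open>The quadratic maps\<close>

text \<open>The element \<open>(x1, x2, x3, a1, a2, a3)\<close> of the direct sum, in concatenated coordinates.\<close>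

definition point ::
  "complex \<Rightarrow> complex \<Rightarrow> complex \<Rightarrow> complex vec \<Rightarrow> complex vec \<Rightarrow> complex vec \<Rightarrow> complex vec" where
  "point x1 x2 x3 a1 a2 a3 = vec_of_list [x1, x2, x3] @\<^sub>v a1 @\<^sub>v a2 @\<^sub>v a3"

definition quad_map :: "nat \<Rightarrow> nat \<Rightarrow> nat \<Rightarrow> complex vec \<Rightarrow> complex vec" where
  "quad_map \<alpha>1 \<alpha>2 \<alpha>3 v =
     (let x1 = v $ 0; x2 = v $ 1; x3 = v $ 2;
          a1 = vec \<alpha>1 (\<lambda>j. v $ (3 + j));
          a2 = vec \<alpha>2 (\<lambda>j. v $ (3 + \<alpha>1 + j));
          a3 = vec \<alpha>3 (\<lambda>j. v $ (3 + \<alpha>1 + \<alpha>2 + j))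
      in point (x2 * x3) (x1 * x3) (x1 * x2) (x1 \<cdot>\<^sub>v a1) (x2 \<cdot>\<^sub>v a2) (x3 \<cdot>\<^sub>v a3))"

lemma quad_map_point:
  assumes "a1 \<in> carrier_vec \<alpha>1" "a2 \<in> carrier_vec \<alpha>2" "a3 \<in> carrier_vec \<alpha>3"
  shows "quad_map \<alpha>1 \<alpha>2 \<alpha>3 (point x1 x2 x3 a1 a2 a3) =
    point (x2 * x3) (x1 * x3) (x1 * x2) (x1 \<cdot>\<^sub>v a1) (x2 \<cdot>\<^sub>v a2) (x3 \<cdot>\<^sub>v a3)"
proof -
  let ?v = "point x1 x2 x3 a1 a2 a3"
  have d: "dim_vec a1 = \<alpha>1" "dim_vec a2 = \<alpha>2" "dim_vec a3 = \<alpha>3"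
    using assms by auto
  define u where "u = vec_of_list [x1, x2, x3]"
  have u: "?v = u @\<^sub>v a1 @\<^sub>v a2 @\<^sub>v a3" "dim_vec u = 3"
    by (simp_all only: point_def u_def) simp
  have "u $ 0 = x1" "u $ 1 = x2" "u $ 2 = x3"
    by (simp_all add: u_def numeral_2_eq_2)
  then have x: "?v $ 0 = x1" "?v $ 1 = x2" "?v $ 2 = x3"
    by (simp_all add: u)
  have "vec \<alpha>1 (\<lambda>j. ?v $ (3 + j)) = a1"
    using d by (intro eq_vecI) (auto simp: u)
  moreover have "vec \<alpha>2 (\<lambda>j. ?v $ (3 + \<alpha>1 + j)) = a2"
    using d by (intro eq_vecI) (auto simp: u)
  moreover have "vec \<alpha>3 (\<lambda>j. ?v $ (3 + \<alpha>1 + \<alpha>2 + j)) = a3"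
    using d by (intro eq_vecI) (auto simp: u)
  ultimately show ?thesis
    by (simp only: quad_map_def Let_def x)
qed

lemma equiv_same_map: "equiv (form_tuples n) (same_map n)"
proof (rule equivI)
  show "same_map n \<subseteq> form_tuples n \<times> form_tuples n" by (auto simp: same_map_def)
  show "refl_on (form_tuples n) (same_map n)" by (auto simp: refl_on_def same_map_def)
  show "sym (same_map n)" by (auto simp: sym_def same_map_def algebra_simps)
  show "trans (same_map n)"
  proof (rule transI)
    fix P Q R assume PQ: "(P, Q) \<in> same_map n" and QR: "(Q, R) \<in> same_map n"
    then have "Q \<in> carrier_vec (n + 1)" "Q \<noteq> 0\<^sub>v (n + 1)"
      by (auto simp: same_map_def form_tuples_def form_tuples_deg_def)
    then obtain k where k: "k < n + 1" "Q $ k \<noteq> 0"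
      by (metis carrier_vecD eq_vecI index_zero_vec)
    have "P $ i * R $ j = P $ j * R $ i" if "i < n + 1" "j < n + 1" for i j
    proof -
      have PQ': "P $ a * Q $ k = P $ k * Q $ a" and QR': "Q $ k * R $ a = Q $ a * R $ k"
        if "a < n + 1" for a
        using PQ QR k that by (auto simp: same_map_def)
      have "(Q $ k * Q $ k) * (P $ i * R $ j) = (P $ i * Q $ k) * (Q $ k * R $ j)"
        by (simp add: mult_ac)
      also have "\<dots> = (P $ j * Q $ k) * (Q $ k * R $ i)"
        using that by (simp only: PQ' QR') (simp add: mult_ac)
      also have "\<dots> = (Q $ k * Q $ k) * (P $ j * R $ i)"
        by (simp add: mult_ac)
      finally show ?thesis using k by simp
    qed
    then show "(P, R) \<in> same_map n" using PQ QR by (auto simp: same_map_def)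
  qed
qed

end

theory Submission
  imports Defs "HOL-Computational_Algebra.Polynomial"
begin

text \<open>Let \<open>A\<close> be the tuple of monomials defining the quadratic map; substituting \<open>A\<close> into itself gives
  \<open>s\<close> times the coordinates \<open>x\<close>, with \<open>s = x\<^sub>1 x\<^sub>2 x\<^sub>3\<close>. If \<open>P\<close> and \<open>Q\<close> are proportional to \<open>A\<close>, say
  \<open>A\<^sub>k Q = Q\<^sub>k A\<close>, then homogeneity relates \<open>P(Q)\<close> to \<open>P(A)\<close> and \<open>A(Q)\<close> to \<open>A(A) = s x\<close>, up to powers
  of \<open>A\<^sub>k\<close> and \<open>Q\<^sub>k\<close>. Hence \<open>P(Q)\<close> is proportional to \<open>x\<close>; it is nonzero because \<open>P(A) = 0\<close> would
  give \<open>0 = P(A(A)) = P(s x)\<close>, a power of \<open>s\<close> times \<open>P\<close>. A common factor of the forms divides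
  \<open>x\<^sub>2 x\<^sub>3\<close>, \<open>x\<^sub>1 x\<^sub>3\<close> and \<open>x\<^sub>1 x\<^sub>2\<close>; divisors of a monomial are monomials up to a scalar, so it is
  constant.\<close>

section \<open>Monomials and evaluation\<close>

definition monomial_value :: "'a::comm_ring_1 vec \<Rightarrow> (nat \<Rightarrow>\<^sub>0 nat) \<Rightarrow> 'a" where
  "monomial_value v m = (\<Prod>i \<in> Poly_Mapping.keys m. v $ i ^ Poly_Mapping.lookup m i)"

definition monomial_degree :: "(nat \<Rightarrow>\<^sub>0 nat) \<Rightarrow> nat" where
  "monomial_degree m = (\<Sum>i \<in> Poly_Mapping.keys m. Poly_Mapping.lookup m i)"

lemma poly_value_alt:
  "poly_value c v p = (\<Sum>m \<in> Poly_Mapping.keys p. c (Poly_Mapping.lookup p m) * monomial_value v m)"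
  by (simp add: poly_value_def monomial_value_def)

lemma is_form_alt:
  "is_form N d p \<longleftrightarrow>
     (\<forall>m \<in> Poly_Mapping.keys p. Poly_Mapping.keys m \<subseteq> {..<N} \<and> monomial_degree m = d)"
  by (auto simp: is_form_def poly_ring_def monomial_degree_def)

text \<open>Exponents outside the support give factors 1, so monomials with different supports can
  be compared over one common index set.\<close>

lemma monomial_value_superset:
  assumes "finite S" "Poly_Mapping.keys m \<subseteq> S"
  shows "monomial_value v m = (\<Prod>i \<in> S. v $ i ^ Poly_Mapping.lookup m i)"
  unfolding monomial_value_def using assms
  by (intro prod.mono_neutral_left) (auto simp: in_keys_iff)

lemma monomial_degree_superset:
  assumes "finite S" "Poly_Mapping.keys m \<subseteq> S"
  shows "monomial_degree m = (\<Sum>i \<in> S. Poly_Mapping.lookup m i)"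
  unfolding monomial_degree_def using assms
  by (intro sum.mono_neutral_left) (auto simp: in_keys_iff)

lemma monomial_value_add: "monomial_value v (m + m') = monomial_value v m * monomial_value v m'"
proof -
  let ?S = "Poly_Mapping.keys m \<union> Poly_Mapping.keys m'"
  have "Poly_Mapping.keys (m + m') \<subseteq> ?S" by (rule keys_add)
  then show ?thesis
    by (simp add: monomial_value_superset[of ?S] lookup_add power_add prod.distrib)
qed

lemma monomial_degree_add: "monomial_degree (m + m') = monomial_degree m + monomial_degree m'"
proof -
  let ?S = "Poly_Mapping.keys m \<union> Poly_Mapping.keys m'"
  have "Poly_Mapping.keys (m + m') \<subseteq> ?S" by (rule keys_add)
  then show ?thesis
    by (simp add: monomial_degree_superset[of ?S] lookup_add sum.distrib)
qed

lemma poly_mapping_eq_sum_single: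
  "p = (\<Sum>m \<in> Poly_Mapping.keys p. Poly_Mapping.single m (Poly_Mapping.lookup p m))"
  by (rule poly_mapping_eqI) (auto simp: lookup_sum lookup_single when_def in_keys_iff)

lemma mult_eq_sum_single:
  fixes p q :: "'a::monoid_add \<Rightarrow>\<^sub>0 'b::semiring_0"
  shows "p * q = (\<Sum>a \<in> Poly_Mapping.keys p. \<Sum>b \<in> Poly_Mapping.keys q.
    Poly_Mapping.single (a + b) (Poly_Mapping.lookup p a * Poly_Mapping.lookup q b))"
  by (subst poly_mapping_eq_sum_single[of p], subst poly_mapping_eq_sum_single[of q])
    (simp add: sum_product mult_single)

text \<open>Two embeddings matter: the identity, for values at complex points, and
  \<open>const_poly\<close>, for substitution of polynomials. The locale treats both at
  once.\<close>

locale coefficient_hom = comm_ring_hom c for c :: "complex \<Rightarrow> 'a::comm_ring_1"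
begin

lemma poly_value_superset:
  assumes "finite S" "Poly_Mapping.keys p \<subseteq> S"
  shows "poly_value c v p = (\<Sum>m \<in> S. c (Poly_Mapping.lookup p m) * monomial_value v m)"
  unfolding poly_value_alt using assms
  by (intro sum.mono_neutral_left) (auto simp: in_keys_iff)

lemma poly_value_add: "poly_value c v (p + q) = poly_value c v p + poly_value c v q"
proof -
  let ?S = "Poly_Mapping.keys p \<union> Poly_Mapping.keys q"
  have "Poly_Mapping.keys (p + q) \<subseteq> ?S" by (rule keys_add)
  then show ?thesis
    by (simp add: poly_value_superset[of ?S] lookup_add hom_add distrib_right sum.distrib)
qed

lemma poly_value_zero: "poly_value c v 0 = 0"
  by (simp add: poly_value_def)

lemma poly_value_sum: "poly_value c v (sum f S) = (\<Sum>s \<in> S. poly_value c v (f s))"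
  by (induction S rule: infinite_finite_induct) (simp_all add: poly_value_zero poly_value_add)

lemma poly_value_single: "poly_value c v (Poly_Mapping.single m a) = c a * monomial_value v m"
  by (simp add: poly_value_superset[of "{m}"])

lemma poly_value_mult: "poly_value c v (p * q) = poly_value c v p * poly_value c v q"
proof -
  have "poly_value c v (p * q) =
      (\<Sum>a \<in> Poly_Mapping.keys p. \<Sum>b \<in> Poly_Mapping.keys q.
         (c (Poly_Mapping.lookup p a) * monomial_value v a) *
         (c (Poly_Mapping.lookup q b) * monomial_value v b))"
    unfolding mult_eq_sum_single[of p q]
    by (simp add: poly_value_sum poly_value_single hom_mult monomial_value_add mult_ac)
  also have "\<dots> = poly_value c v p * poly_value c v q"
    by (simp add: poly_value_alt sum_product)
  finally show ?thesis .
qed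

lemma poly_value_variable: "poly_value c v (variable i) = v $ i"
  by (simp add: variable_def poly_value_single monomial_value_def)

lemma poly_value_const: "poly_value c v (const_poly a) = c a"
  by (simp add: const_poly_def poly_value_single monomial_value_def)

lemma comm_ring_hom_poly_value: "comm_ring_hom (poly_value c v)"
proof
  show "poly_value c v 1 = 1"
    using poly_value_const[of v 1] by (simp add: const_poly_def)
qed (simp_all add: poly_value_zero poly_value_add poly_value_mult)

end

interpretation const_coeff: coefficient_hom const_poly
  by unfold_locales (simp_all add: const_poly_def single_add mult_single)

text \<open>Not an interpretation: the simp rules it would add make the simplifier loop.\<close>

lemma coefficient_hom_id: "coefficient_hom (\<lambda>a. a)"
  by unfold_locales simp_all

text \<open>A ring homomorphism commutes with the finite sums, products and powers in
  \<open>poly_value\<close>. The bound on the variables keeps every index inside \<open>v\<close>,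
  where \<open>map_vec\<close> acts entrywise.\<close>

lemma hom_poly_value:
  assumes "comm_ring_hom h" "p \<in> poly_ring (dim_vec v)"
  shows "h (poly_value c v p) = poly_value (\<lambda>a. h (c a)) (map_vec h v) p"
proof -
  interpret comm_ring_hom h by fact
  have "h (monomial_value v m) = monomial_value (map_vec h v) m" if "m \<in> Poly_Mapping.keys p" for m
    using that assms(2)
    by (auto simp: monomial_value_def hom_prod hom_power poly_ring_def subset_iff intro!: prod.cong)
  then show ?thesis
    by (simp add: poly_value_alt hom_sum hom_mult)
qed

text \<open>Substitution of \<open>Q\<close> is a ring homomorphism fixing the constants, so it
  passes inside the substitution of \<open>P\<close>.\<close>

lemma subst_assoc:
  assumes "p \<in> poly_ring (dim_vec P)"
  shows "poly_value const_poly (subst_tuple P Q) p =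
    poly_value const_poly Q (poly_value const_poly P p)"
  unfolding subst_tuple_def
  by (simp add: hom_poly_value[OF const_coeff.comm_ring_hom_poly_value assms]
      const_coeff.poly_value_const)

text \<open>Homogeneity makes both sides the value of \<open>p\<close> at the common tuple
  \<open>s u = t w\<close>. Two factors are allowed because proportional tuples of polynomials need
  not be multiples of one another.\<close>

lemma form_value_proportional:
  assumes "is_form N d p" "\<And>i. i < N \<Longrightarrow> s * u $ i = t * w $ i"
  shows "s ^ d * poly_value c u p = t ^ d * poly_value c w p"
proof -
  have scale: "r ^ monomial_degree m * monomial_value v m =
      (\<Prod>i \<in> Poly_Mapping.keys m. (r * v $ i) ^ Poly_Mapping.lookup m i)"
    for r :: 'a and v m
    by (simp add: monomial_degree_def monomial_value_def power_sum power_mult_distrib prod.distrib)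
  have "s ^ d * monomial_value u m = t ^ d * monomial_value w m"
    if "m \<in> Poly_Mapping.keys p" for m
  proof -
    have "monomial_degree m = d" "Poly_Mapping.keys m \<subseteq> {..<N}"
      using assms(1) that by (auto simp: is_form_alt)
    then show ?thesis
      using scale[of s m u] scale[of t m w] assms(2) by (auto intro!: prod.cong)
  qed
  then show ?thesis
    unfolding poly_value_alt sum_distrib_left
    by (intro sum.cong refl) (metis mult.left_commute)
qed

lemma variable_power: "variable i ^ k = Poly_Mapping.single (Poly_Mapping.single i k) 1"
  by (induction k) (simp_all add: variable_def mult_single flip: single_add)

lemma prod_single_one:
  "(\<Prod>i \<in> S. Poly_Mapping.single (f i) (1::'b::comm_semiring_1)) =
    Poly_Mapping.single (\<Sum>i \<in> S. f i) 1"
  by (induction S rule: infinite_finite_induct) (simp_all add: mult_single)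

lemma subst_variables:
  assumes "p \<in> poly_ring N"
  shows "poly_value const_poly (vec N variable) p = p"
proof -
  have "const_poly a * monomial_value (vec N variable) m = Poly_Mapping.single m a"
    if "m \<in> Poly_Mapping.keys p" for m a
  proof -
    have "monomial_value (vec N variable) m =
        (\<Prod>i \<in> Poly_Mapping.keys m. Poly_Mapping.single (Poly_Mapping.single i (Poly_Mapping.lookup m i)) 1)"
      using that assms unfolding monomial_value_def
      by (intro prod.cong) (auto simp: poly_ring_def variable_power subset_iff)
    also have "\<dots> = Poly_Mapping.single m 1"
      by (simp add: prod_single_one flip: poly_mapping_eq_sum_single)
    finally show ?thesis by (simp add: const_poly_def mult_single)
  qed
  then show ?thesis
    by (simp add: poly_value_alt flip: poly_mapping_eq_sum_single)
qed


section \<open>Forms\<close>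

lemma is_form_zero: "is_form N d 0"
  by (simp add: is_form_alt)

lemma is_form_add: "is_form N d p \<Longrightarrow> is_form N d q \<Longrightarrow> is_form N d (p + q)"
  using keys_add[of p q] by (auto simp: is_form_alt)

lemma is_form_sum: "(\<And>s. s \<in> S \<Longrightarrow> is_form N d (f s)) \<Longrightarrow> is_form N d (sum f S)"
  by (induction S rule: infinite_finite_induct) (simp_all add: is_form_zero is_form_add)

lemma is_form_mult:
  assumes "is_form N d p" "is_form N e q"
  shows "is_form N (d + e) (p * q)"
  unfolding is_form_alt
proof
  fix m assume "m \<in> Poly_Mapping.keys (p * q)"
  then obtain a b where ab: "a \<in> Poly_Mapping.keys p" "b \<in> Poly_Mapping.keys q" "m = a + b"
    using keys_mult[of p q] by blast
  then show "Poly_Mapping.keys m \<subseteq> {..<N} \<and> monomial_degree m = d + e"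
    using assms keys_add[of a b] by (fastforce simp: is_form_alt monomial_degree_add)
qed

lemma is_form_const: "is_form N 0 (const_poly a)"
  by (simp add: is_form_alt const_poly_def monomial_degree_def)

lemma is_form_variable: "i < N \<Longrightarrow> is_form N 1 (variable i)"
  by (simp add: is_form_alt variable_def monomial_degree_def)

lemma is_form_power: "is_form N e q \<Longrightarrow> is_form N (e * k) (q ^ k)"
proof (induction k)
  case 0
  then show ?case using is_form_const[of N 1] by (simp add: const_poly_def)
next
  case (Suc k)
  then show ?case using is_form_mult[of N e q "e * k" "q ^ k"] by simp
qed

lemma is_form_prod:
  "(\<And>s. s \<in> S \<Longrightarrow> is_form N (g s) (f s)) \<Longrightarrow> is_form N (sum g S) (prod f S)"
proof (induction S rule: infinite_finite_induct)
  case (insert x F)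
  then show ?case by (simp add: is_form_mult)
qed (use is_form_const[of N 1] in \<open>simp_all add: const_poly_def\<close>)

text \<open>A monomial of degree \<open>d\<close> in forms of degree \<open>e\<close> is a form of
  degree \<open>d * e\<close>; thus a composite of form tuples again has components of one common
  degree.\<close>

lemma is_form_subst:
  assumes "is_form M d p" "\<And>i. i < M \<Longrightarrow> is_form N e (Q $ i)"
  shows "is_form N (d * e) (poly_value const_poly Q p)"
  unfolding poly_value_alt
proof (rule is_form_sum)
  fix m assume "m \<in> Poly_Mapping.keys p"
  then have m: "Poly_Mapping.keys m \<subseteq> {..<M}" "monomial_degree m = d"
    using assms(1) by (auto simp: is_form_alt)
  then have "is_form N (\<Sum>i \<in> Poly_Mapping.keys m. e * Poly_Mapping.lookup m i) (monomial_value Q m)"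
    unfolding monomial_value_def using assms(2) by (intro is_form_prod is_form_power) auto
  then have "is_form N (d * e) (monomial_value Q m)"
    using m(2) by (simp add: monomial_degree_def mult.commute flip: sum_distrib_left)
  then show "is_form N (d * e) (const_poly (Poly_Mapping.lookup p m) * monomial_value Q m)"
    using is_form_mult[OF is_form_const] by force
qed

lemma is_form_poly_ring: "is_form N d p \<Longrightarrow> p \<in> poly_ring N"
  by (simp add: is_form_def)


section \<open>Polynomials as functions\<close>

text \<open>Reduction modulo \<open>D\<close> isolates the lowest digit; cancelling it and dividing
  by \<open>D\<close> leaves shorter expansions for the induction.\<close>

lemma digit_expansion_unique:
  fixes f g :: "nat \<Rightarrow> nat"
  assumes "\<And>i. i < N \<Longrightarrow> f i < D" "\<And>i. i < N \<Longrightarrow> g i < D"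
    and "(\<Sum>i<N. f i * D ^ i) = (\<Sum>i<N. g i * D ^ i)" "i < N"
  shows "f i = g i"
  using assms
proof (induction N arbitrary: f g i)
  case (Suc N)
  have split: "(\<Sum>i<Suc N. h i * D ^ i) = h 0 + D * (\<Sum>i<N. h (Suc i) * D ^ i)" for h
    by (subst sum.lessThan_Suc_shift) (simp add: sum_distrib_left mult_ac)
  have D: "f 0 < D" "g 0 < D" using Suc.prems by auto
  have eq: "f 0 + D * (\<Sum>i<N. f (Suc i) * D ^ i) = g 0 + D * (\<Sum>i<N. g (Suc i) * D ^ i)"
    using Suc.prems(3) by (simp only: split)
  from arg_cong[OF eq, of "\<lambda>x. x mod D"] have "f 0 = g 0" using D by simp
  moreover from this eq D have "(\<Sum>i<N. f (Suc i) * D ^ i) = (\<Sum>i<N. g (Suc i) * D ^ i)"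
    by simp
  then have "f (Suc j) = g (Suc j)" if "j < N" for j
    using Suc.IH[of "\<lambda>i. f (Suc i)" "\<lambda>i. g (Suc i)" j] Suc.prems(1,2) that by simp
  ultimately show ?case using Suc.prems(4) by (cases i) auto
qed simp

text \<open>Kronecker substitution: for large \<open>D\<close>, setting the \<open>i\<close>-th variable to \<open>t ^ D ^ i\<close> sends distinct
  monomials of \<open>p\<close> to distinct powers of \<open>t\<close>.\<close>

lemma poly_eq_zero_if_values_zero:
  assumes p: "p \<in> poly_ring N"
    and zero: "\<And>v. v \<in> carrier_vec N \<Longrightarrow> poly_value (\<lambda>a. a) v p = 0"
  shows "p = 0"
proof -
  \<comment> \<open>The sum of all degrees bounds every exponent occurring in \<open>p\<close>; the
    successor makes the bound strict, so exponents are digits in base \<open>D\<close>.\<close>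
  define D where "D = Suc (\<Sum>m \<in> Poly_Mapping.keys p. monomial_degree m)"
  define e where "e m = (\<Sum>i<N. Poly_Mapping.lookup m i * D ^ i)" for m :: "nat \<Rightarrow>\<^sub>0 nat"
  define q where "q = (\<Sum>m \<in> Poly_Mapping.keys p. monom (Poly_Mapping.lookup p m) (e m))"
  have keys: "Poly_Mapping.keys m \<subseteq> {..<N}" if "m \<in> Poly_Mapping.keys p" for m
    using p that by (auto simp: poly_ring_def)
  have less: "Poly_Mapping.lookup m i < D" if "m \<in> Poly_Mapping.keys p" "i < N" for m i
  proof -
    have "Poly_Mapping.lookup m i \<le> (\<Sum>i<N. Poly_Mapping.lookup m i)"
      using that by (intro member_le_sum) auto
    also have "\<dots> = monomial_degree m"
      using keys[OF that(1)] by (simp add: monomial_degree_superset[of "{..<N}"])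
    also have "\<dots> < D"
      unfolding D_def less_Suc_eq_le using that(1) by (intro member_le_sum) auto
    finally show ?thesis .
  qed
  have inj: "m = m'" if m: "m \<in> Poly_Mapping.keys p" "m' \<in> Poly_Mapping.keys p" and "e m = e m'" for m m'
  proof (rule poly_mapping_eqI)
    fix i
    show "Poly_Mapping.lookup m i = Poly_Mapping.lookup m' i"
    proof (cases "i < N")
      case True
      then show ?thesis
        using digit_expansion_unique[of N "Poly_Mapping.lookup m" D "Poly_Mapping.lookup m'" i]
          less m \<open>e m = e m'\<close> by (simp add: e_def)
    next
      case False
      then have "i \<notin> Poly_Mapping.keys m" "i \<notin> Poly_Mapping.keys m'" using keys m by blast+
      then show ?thesis by (simp add: in_keys_iff)
    qed
  qed
  have "poly q t = 0" for t
  proof -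
    have "monomial_value (vec N (\<lambda>i. t ^ D ^ i)) m = t ^ e m" if "m \<in> Poly_Mapping.keys p" for m
      using keys[OF that]
      by (simp add: monomial_value_superset[of "{..<N}"] e_def power_sum mult.commute flip: power_mult)
    then have "poly q t = poly_value (\<lambda>a. a) (vec N (\<lambda>i. t ^ D ^ i)) p"
      by (simp add: q_def poly_sum poly_monom poly_value_alt)
    then show ?thesis using zero by simp
  qed
  \<comment> \<open>A univariate polynomial vanishing at every complex number is zero.\<close>
  then have "q = 0" using poly_all_0_iff_0 by blast
  have "Poly_Mapping.lookup p m = 0" if m: "m \<in> Poly_Mapping.keys p" for m
  proof -
    \<comment> \<open>By injectivity of \<open>e\<close> on the monomials of \<open>p\<close>, no
      other monomial contributes to this coefficient.\<close>
    have "coeff q (e m) = (\<Sum>m' \<in> Poly_Mapping.keys p. if m' = m then Poly_Mapping.lookup p m' else 0)"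
      unfolding q_def coeff_sum coeff_monom using inj m by (intro sum.cong) auto
    then show ?thesis using \<open>q = 0\<close> m by simp
  qed
  then show ?thesis by (metis keys_eq_empty all_not_in_conv in_keys_iff)
qed

lemma poly_eq_if_values_eq:
  assumes "p \<in> poly_ring N" "q \<in> poly_ring N"
    and "\<And>v. v \<in> carrier_vec N \<Longrightarrow> poly_value (\<lambda>a. a) v p = poly_value (\<lambda>a. a) v q"
  shows "p = q"
proof -
  have "p - q \<in> poly_ring N"
    using assms(1,2) keys_diff[of p q] by (auto simp: poly_ring_def)
  moreover have "poly_value (\<lambda>a. a) v (p - q) = 0" if "v \<in> carrier_vec N" for v
    using coefficient_hom.poly_value_add[OF coefficient_hom_id, of v "p - q" q] assms(3)[OF that]
    by simp
  ultimately have "p - q = 0" by (rule poly_eq_zero_if_values_zero)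
  then show ?thesis by simp
qed


section \<open>Divisors of monomials\<close>

text \<open>Only the pair \<open>(x, y)\<close> contributes to this coefficient of the convolution,
  so nothing can cancel.\<close>

lemma lookup_mult_unique_sum:
  fixes p q :: "'a::monoid_add \<Rightarrow>\<^sub>0 'b::semiring_0"
  assumes "x \<in> Poly_Mapping.keys p" "y \<in> Poly_Mapping.keys q"
    and unique: "\<And>a b. a \<in> Poly_Mapping.keys p \<Longrightarrow> b \<in> Poly_Mapping.keys q \<Longrightarrow>
      a + b = x + y \<Longrightarrow> a = x \<and> b = y"
  shows "Poly_Mapping.lookup (p * q) (x + y) = Poly_Mapping.lookup p x * Poly_Mapping.lookup q y"
proof -
  have "Poly_Mapping.lookup (p * q) (x + y) =
      (\<Sum>a \<in> Poly_Mapping.keys p. \<Sum>b \<in> Poly_Mapping.keys q.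
        if a = x then if b = y then Poly_Mapping.lookup p a * Poly_Mapping.lookup q b else 0 else 0)"
    unfolding mult_eq_sum_single[of p q] lookup_sum lookup_single
    using unique by (intro sum.cong refl) (auto simp: when_def)
  also have "\<dots> = (\<Sum>a \<in> Poly_Mapping.keys p.
      if a = x then Poly_Mapping.lookup p a * Poly_Mapping.lookup q y else 0)"
    using assms(2) by (intro sum.cong refl) simp
  finally show ?thesis using assms(1) by simp
qed

text \<open>The largest and the smallest monomial of a product are the products of the largest and of the
  smallest monomials of the factors.\<close>

lemma divisor_of_single:
  fixes p q :: "'a::{ordered_cancel_comm_monoid_add, linorder} \<Rightarrow>\<^sub>0 'b::semiring_no_zero_divisors"
  assumes pq: "p * q = Poly_Mapping.single k c" and "c \<noteq> 0"
  obtains m m' where "Poly_Mapping.keys p = {m}" "m + m' = k"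
proof -
  let ?S = "Poly_Mapping.keys p" and ?T = "Poly_Mapping.keys q"
  have "p \<noteq> 0" "q \<noteq> 0"
    using pq \<open>c \<noteq> 0\<close> by (metis keys_single keys_zero insert_not_empty mult_zero_left mult_zero_right)+
  then have ne: "?S \<noteq> {}" "?T \<noteq> {}" by auto
  \<comment> \<open>A sum attained by a single pair has a nonzero coefficient in the product, and
    \<open>k\<close> is the only exponent with that property.\<close>
  have mem: "x + y = k" if "x \<in> ?S" "y \<in> ?T"
    "\<And>a b. a \<in> ?S \<Longrightarrow> b \<in> ?T \<Longrightarrow> a + b = x + y \<Longrightarrow> a = x \<and> b = y" for x y
  proof -
    have "Poly_Mapping.lookup (p * q) (x + y) = Poly_Mapping.lookup p x * Poly_Mapping.lookup q y"
      by (rule lookup_mult_unique_sum) (use that in blast)+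
    then have "Poly_Mapping.lookup (p * q) (x + y) \<noteq> 0"
      using that(1,2) by (simp add: in_keys_iff)
    then show ?thesis by (auto simp: pq lookup_single when_def split: if_splits)
  qed
  have max: "Max ?S + Max ?T = k"
  proof (rule mem)
    fix a b assume "a \<in> ?S" "b \<in> ?T" and eq: "a + b = Max ?S + Max ?T"
    then have "a \<le> Max ?S" "b \<le> Max ?T" by auto
    then show "a = Max ?S \<and> b = Max ?T"
      using eq add_less_le_mono[of a "Max ?S" b "Max ?T"] add_le_less_mono[of a "Max ?S" b "Max ?T"]
      by (auto simp: order_le_less)
  qed (use ne in auto)
  have min: "Min ?S + Min ?T = k"
  proof (rule mem)
    fix a b assume "a \<in> ?S" "b \<in> ?T" and eq: "a + b = Min ?S + Min ?T"
    then have "Min ?S \<le> a" "Min ?T \<le> b" by auto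
    then show "a = Min ?S \<and> b = Min ?T"
      using eq add_less_le_mono[of "Min ?S" a "Min ?T" b] add_le_less_mono[of "Min ?S" a "Min ?T" b]
      by (auto simp: order_le_less)
  qed (use ne in auto)
  \<comment> \<open>Both extreme sums equal \<open>k\<close>, so a strict inequality between minimum
    and maximum would contradict strict monotonicity of addition.\<close>
  have "Min ?S \<le> Max ?S" "Min ?T \<le> Max ?T" using ne by auto
  then have "Min ?S = Max ?S"
    using max min add_less_le_mono[of "Min ?S" "Max ?S" "Min ?T" "Max ?T"] by (auto simp: order_le_less)
  then have "?S = {Max ?S}"
    using ne by (metis Max_ge Max_in Min_le antisym finite_keys is_singletonI' is_singleton_def singletonD)
  then show ?thesis using that max by blast
qed


section \<open>Rational maps given by involutions up to a factor\<close>

lemma form_tuplesE: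
  assumes "P \<in> form_tuples n"
  obtains d where "dim_vec P = n + 1" "\<forall>i<n + 1. is_form (n + 1) d (P $ i)"
    "\<exists>k<n + 1. P $ k \<noteq> 0"
proof -
  obtain d where "P \<in> form_tuples_deg n d" using assms by (auto simp: form_tuples_def)
  then have P: "dim_vec P = n + 1" "\<forall>i<n + 1. is_form (n + 1) d (P $ i)" "P \<noteq> 0\<^sub>v (n + 1)"
    by (auto simp: form_tuples_deg_def)
  from P(1,3) have "\<exists>k<n + 1. P $ k \<noteq> 0" by (metis eq_vecI index_zero_vec)
  with P that show ?thesis by blast
qed

lemma form_tuplesI:
  assumes "dim_vec P = n + 1" "\<And>i. i < n + 1 \<Longrightarrow> is_form (n + 1) d (P $ i)"
    "k < n + 1" "P $ k \<noteq> 0"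
  shows "P \<in> form_tuples_deg n d" "P \<in> form_tuples n"
proof -
  have "P \<noteq> 0\<^sub>v (n + 1)" using assms(3,4) by auto
  moreover have "P \<in> carrier_vec (n + 1)" using assms(1) by (rule carrier_vecI)
  ultimately show "P \<in> form_tuples_deg n d"
    using assms(2) unfolding form_tuples_deg_def by blast
  then show "P \<in> form_tuples n" by (auto simp: form_tuples_def)
qed

lemma variable_nonzero: "variable i \<noteq> 0"
  unfolding variable_def by (metis keys_single keys_zero insert_not_empty one_neq_zero)

text \<open>Polynomials with equal values are equal, so the union defining
  \<open>projectivization\<close> runs over the single tuple \<open>P\<close>.\<close>

lemma projectivization_eq:
  assumes "P \<in> form_tuples n" "\<And>v. v \<in> carrier_vec (n + 1) \<Longrightarrow> eval_tuple P v = F v"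
  shows "projectivization n F = same_map n `` {P}"
proof -
  have "Q = P" if Q: "Q \<in> form_tuples n" "\<And>v. v \<in> carrier_vec (n + 1) \<Longrightarrow> eval_tuple Q v = F v" for Q
  proof -
    obtain d where P': "dim_vec P = n + 1" "\<forall>i<n + 1. is_form (n + 1) d (P $ i)"
      "\<exists>k<n + 1. P $ k \<noteq> 0"
      using assms(1) by (rule form_tuplesE)
    obtain e where Q': "dim_vec Q = n + 1" "\<forall>i<n + 1. is_form (n + 1) e (Q $ i)"
      "\<exists>k<n + 1. Q $ k \<noteq> 0"
      using Q(1) by (rule form_tuplesE)
    show ?thesis
    proof (rule eq_vecI)
      fix i assume "i < dim_vec P"
      then have i: "i < n + 1" using P' by simp
      show "Q $ i = P $ i"
      proof (rule poly_eq_if_values_eq)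
        show "Q $ i \<in> poly_ring (n + 1)" "P $ i \<in> poly_ring (n + 1)"
          using P'(2) Q'(2) i is_form_poly_ring by blast+
        fix v :: "complex vec" assume "v \<in> carrier_vec (n + 1)"
        then have "eval_tuple Q v $ i = eval_tuple P v $ i" using assms(2) Q(2) by simp
        then show "poly_value (\<lambda>a. a) v (Q $ i) = poly_value (\<lambda>a. a) v (P $ i)"
          using P'(1) Q'(1) i by (simp add: eval_tuple_def)
      qed
    qed (simp add: P' Q')
  qed
  then have "{Q \<in> form_tuples n. \<forall>v \<in> carrier_vec (n + 1). eval_tuple Q v = F v} = {P}"
    using assms by blast
  then show ?thesis by (simp add: projectivization_def)
qed

text \<open>The composite is formed from all pairs of representatives, so the identity must be
  verified for arbitrary \<open>P\<close> and \<open>Q\<close> in the class of \<open>A\<close>, not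
  only for \<open>A\<close> itself.\<close>

lemma same_map_subst_variables:
  assumes A: "A \<in> form_tuples n"
    and s: "s \<noteq> 0" "\<And>i. i < n + 1 \<Longrightarrow> subst_tuple A A $ i = s * variable i"
    and P: "(A, P) \<in> same_map n" and Q: "(A, Q) \<in> same_map n"
  shows "(subst_tuple P Q, vec (n + 1) variable) \<in> same_map n"
proof -
  let ?N = "n + 1" and ?X = "vec (n + 1) variable :: cpoly vec"
  let ?sub = "poly_value const_poly :: cpoly vec \<Rightarrow> _"
  have PQ: "P \<in> form_tuples n" "Q \<in> form_tuples n"
    and AP: "\<And>i j. i < ?N \<Longrightarrow> j < ?N \<Longrightarrow> A $ i * P $ j = A $ j * P $ i"
    and AQ: "\<And>i j. i < ?N \<Longrightarrow> j < ?N \<Longrightarrow> A $ i * Q $ j = A $ j * Q $ i"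
    using P Q by (auto simp: same_map_def)
  obtain a where A': "dim_vec A = ?N" "\<forall>i<?N. is_form ?N a (A $ i)"
      "\<exists>k<?N. A $ k \<noteq> 0"
    using A by (rule form_tuplesE)
  then obtain k where k: "k < ?N" "A $ k \<noteq> 0" by blast
  obtain d where P': "dim_vec P = ?N" "\<forall>i<?N. is_form ?N d (P $ i)"
      and "\<exists>l<?N. P $ l \<noteq> 0"
    using PQ(1) by (rule form_tuplesE)
  then obtain l where l: "l < ?N" "P $ l \<noteq> 0" by blast
  obtain b where Q': "dim_vec Q = ?N" "\<forall>i<?N. is_form ?N b (Q $ i)"
      and "\<exists>r<?N. Q $ r \<noteq> 0"
    using PQ(2) by (rule form_tuplesE)
  \<comment> \<open>If \<open>Q $ k\<close> vanished, \<open>A $ k * Q $ j = A $ j * Q $ k\<close>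
    would force every \<open>Q $ j\<close> to vanish.\<close>
  then have Qk: "Q $ k \<noteq> 0" using AQ[OF k(1)] k by fastforce
  have subst_index: "subst_tuple R S $ i = ?sub S (R $ i)" if "dim_vec R = ?N" "i < ?N" for R S i
    using that by (simp add: subst_tuple_def)
  have hom: "?sub Q (p * q) = ?sub Q p * ?sub Q q" for p q
    by (rule const_coeff.poly_value_mult)
  \<comment> \<open>The tuples satisfy \<open>A $ k * Q = Q $ k * A\<close>, so homogeneity compares
    the substitutions of \<open>Q\<close> and of \<open>A\<close>.\<close>
  have scaled: "A $ k ^ e * ?sub Q p = Q $ k ^ e * ?sub A p" if "is_form ?N e p" for p e
    using that by (rule form_value_proportional) (use AQ[OF k(1)] in \<open>simp add: mult.commute\<close>)
  \<comment> \<open>Substituting \<open>A\<close> into itself yields \<open>s\<close> times the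
    coordinates, and a form of degree \<open>e\<close> turns the factor \<open>s\<close> into
    \<open>s ^ e\<close>.\<close>
  have twice: "?sub (subst_tuple A A) p = s ^ e * p" if "is_form ?N e p" for p e
  proof -
    have "1 ^ e * ?sub (subst_tuple A A) p = s ^ e * ?sub ?X p"
      using that by (rule form_value_proportional) (simp add: s(2))
    then show ?thesis using subst_variables[OF is_form_poly_ring[OF that]] by simp
  qed
  have "?sub Q (P $ l) \<noteq> 0"
  proof
    \<comment> \<open>Vanishing carries over from \<open>Q\<close> to \<open>A\<close>; substituting
      \<open>A\<close> once more turns it into \<open>s ^ d * P $ l = 0\<close>, which is
      impossible.\<close>
    assume "?sub Q (P $ l) = 0"
    then have "?sub A (P $ l) = 0" using scaled[OF P'(2)[rule_format, OF l(1)]] Qk by simp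
    moreover have "?sub A (?sub A (P $ l)) = s ^ d * P $ l"
      using twice[OF P'(2)[rule_format, OF l(1)]] subst_assoc[of "P $ l" A A] is_form_poly_ring[OF P'(2)[rule_format, OF l(1)]] A'(1)
      by simp
    ultimately show False using l s(1) by (simp add: const_coeff.poly_value_zero)
  qed
  then have form: "subst_tuple P Q \<in> form_tuples n"
    using l(1) P' Q'
    by (intro form_tuplesI(2)[where k = l and d = "d * b"])
      (auto simp: subst_index subst_tuple_def is_form_subst)
  have "?sub Q (P $ i) * variable j = ?sub Q (P $ j) * variable i" if ij: "i < ?N" "j < ?N" for i j
  proof -
    have A_Q: "A $ k ^ a * ?sub Q (A $ t) = Q $ k ^ a * s * variable t" if "t < ?N" for t
      using scaled[OF A'(2)[rule_format, OF that]] s(2)[OF that] subst_index[OF A'(1) that] by (simp add: mult.assoc)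
    \<comment> \<open>This is the proportionality of \<open>A\<close> and \<open>P\<close> after
      substitution of \<open>Q\<close>. Replacing \<open>A\<close> of \<open>Q\<close> by multiples
      of the coordinates and cancelling the nonzero factor \<open>Q $ k ^ a * s\<close> gives the
      claim.\<close>
    have "?sub Q (A $ j) * ?sub Q (P $ i) = ?sub Q (A $ i) * ?sub Q (P $ j)"
      using AP[OF ij(2,1)] by (metis hom)
    then have "(A $ k ^ a * ?sub Q (A $ j)) * ?sub Q (P $ i) =
        (A $ k ^ a * ?sub Q (A $ i)) * ?sub Q (P $ j)"
      by (simp add: mult.assoc)
    then have "(Q $ k ^ a * s) * (variable j * ?sub Q (P $ i)) =
        (Q $ k ^ a * s) * (variable i * ?sub Q (P $ j))"
      by (simp only: A_Q ij mult.assoc)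
    then show ?thesis using Qk s(1) by (simp add: mult.commute)
  qed
  moreover have "?X \<in> form_tuples n"
    using variable_nonzero by (intro form_tuplesI(2)[where k = 0 and d = 1]) (auto intro: is_form_variable[simplified])
  ultimately show ?thesis
    using form by (auto simp: same_map_def subst_index P'(1))
qed

lemma compose_map_self:
  assumes A: "A \<in> form_tuples n"
    and s: "s \<noteq> 0" "\<And>i. i < n + 1 \<Longrightarrow> subst_tuple A A $ i = s * variable i"
  shows "compose_map n (same_map n `` {A}) (same_map n `` {A}) = id_map n"
proof -
  \<comment> \<open>Reflexivity makes the class of \<open>A\<close> nonempty, so the union defining
    the composite is not empty.\<close>
  have "(A, A) \<in> same_map n" using A by (simp add: same_map_def)
  moreover have "{R. (subst_tuple P Q, R) \<in> same_map n} = id_map n"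
    if "(A, P) \<in> same_map n" "(A, Q) \<in> same_map n" for P Q
    using equiv_class_eq[OF equiv_same_map same_map_subst_variables[OF A s that]]
    by (auto simp: id_map_def)
  ultimately show ?thesis unfolding compose_map_def by auto
qed


section \<open>The quadratic forms\<close>

text \<open>For \<open>k \<ge> 3\<close>, the index of the coordinate that multiplies the \<open>k\<close>-th one.\<close>

definition block :: "nat \<Rightarrow> nat \<Rightarrow> nat \<Rightarrow> nat" where
  "block \<alpha>1 \<alpha>2 k = (if k < 3 + \<alpha>1 then 0 else if k < 3 + \<alpha>1 + \<alpha>2 then 1 else 2)"

text \<open>Every component is a product of two coordinates. Recording their indices lets the map,
  its forms and their substitution share one description.\<close>

definition factor_indices :: "nat \<Rightarrow> nat \<Rightarrow> nat \<Rightarrow> nat \<times> nat" where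
  "factor_indices \<alpha>1 \<alpha>2 k =
     (if k = 0 then (1, 2) else if k = 1 then (0, 2) else if k = 2 then (0, 1)
      else (block \<alpha>1 \<alpha>2 k, k))"

definition quad_forms :: "nat \<Rightarrow> nat \<Rightarrow> nat \<Rightarrow> cpoly vec" where
  "quad_forms \<alpha>1 \<alpha>2 \<alpha>3 = vec (3 + (\<alpha>1 + \<alpha>2 + \<alpha>3))
     (\<lambda>k. case factor_indices \<alpha>1 \<alpha>2 k of (i, j) \<Rightarrow> variable i * variable j)"

lemma block_cases: "block \<alpha>1 \<alpha>2 k = 0 \<or> block \<alpha>1 \<alpha>2 k = 1 \<or> block \<alpha>1 \<alpha>2 k = 2"
  by (simp add: block_def)

lemma dim_point [simp]:
  "dim_vec (point x1 x2 x3 a1 a2 a3) = 3 + (dim_vec a1 + dim_vec a2 + dim_vec a3)"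
  by (simp add: point_def)

lemma index_point:
  assumes "k < 3 + (dim_vec a1 + dim_vec a2 + dim_vec a3)"
  shows "point x1 x2 x3 a1 a2 a3 $ k =
    (if k = 0 then x1 else if k = 1 then x2 else if k = 2 then x3
     else if k < 3 + dim_vec a1 then a1 $ (k - 3)
     else if k < 3 + dim_vec a1 + dim_vec a2 then a2 $ (k - 3 - dim_vec a1)
     else a3 $ (k - 3 - dim_vec a1 - dim_vec a2))"
proof -
  define u where "u = vec_of_list [x1, x2, x3]"
  have u: "dim_vec u = 3" "u $ 0 = x1" "u $ 1 = x2" "u $ 2 = x3"
    by (simp_all add: u_def numeral_2_eq_2)
  have "point x1 x2 x3 a1 a2 a3 = u @\<^sub>v a1 @\<^sub>v a2 @\<^sub>v a3"
    by (simp only: point_def u_def)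
  moreover have "k = 0 \<or> k = 1 \<or> k = 2 \<or> k \<ge> 3" by linarith
  ultimately show ?thesis using assms u by auto
qed

lemma quad_map_index:
  assumes "k < 3 + (\<alpha>1 + \<alpha>2 + \<alpha>3)"
  shows "quad_map \<alpha>1 \<alpha>2 \<alpha>3 v $ k = (case factor_indices \<alpha>1 \<alpha>2 k of (i, j) \<Rightarrow> v $ i * v $ j)"
  using assms by (auto simp: quad_map_def Let_def index_point factor_indices_def block_def)

lemma eval_quad_forms:
  "eval_tuple (quad_forms \<alpha>1 \<alpha>2 \<alpha>3) v = quad_map \<alpha>1 \<alpha>2 \<alpha>3 v"
proof (rule eq_vecI)
  show "dim_vec (eval_tuple (quad_forms \<alpha>1 \<alpha>2 \<alpha>3) v) = dim_vec (quad_map \<alpha>1 \<alpha>2 \<alpha>3 v)"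
    by (simp add: eval_tuple_def quad_forms_def quad_map_def Let_def)
  fix k assume "k < dim_vec (quad_map \<alpha>1 \<alpha>2 \<alpha>3 v)"
  then have "k < 3 + (\<alpha>1 + \<alpha>2 + \<alpha>3)" by (simp add: quad_map_def Let_def)
  then show "eval_tuple (quad_forms \<alpha>1 \<alpha>2 \<alpha>3) v $ k = quad_map \<alpha>1 \<alpha>2 \<alpha>3 v $ k"
    by (simp add: quad_map_index eval_tuple_def quad_forms_def split_beta
        coefficient_hom.poly_value_mult[OF coefficient_hom_id]
        coefficient_hom.poly_value_variable[OF coefficient_hom_id])
qed

lemma quad_forms_form_tuples:
  assumes "n = 2 + (\<alpha>1 + \<alpha>2 + \<alpha>3)"
  shows "quad_forms \<alpha>1 \<alpha>2 \<alpha>3 \<in> form_tuples_deg n 2" "quad_forms \<alpha>1 \<alpha>2 \<alpha>3 \<in> form_tuples n"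
proof -
  have form: "is_form (n + 1) 2 (quad_forms \<alpha>1 \<alpha>2 \<alpha>3 $ k)" if k: "k < n + 1" for k
  proof -
    obtain i j where ij: "factor_indices \<alpha>1 \<alpha>2 k = (i, j)" by fastforce
    then have "i < n + 1" "j < n + 1"
      using k assms block_cases[of \<alpha>1 \<alpha>2 k] by (auto simp: factor_indices_def split: if_splits)
    then have "is_form (n + 1) (1 + 1) (variable i * variable j)"
      by (intro is_form_mult is_form_variable)
    moreover have "quad_forms \<alpha>1 \<alpha>2 \<alpha>3 $ k = variable i * variable j"
      using k ij assms by (simp add: quad_forms_def)
    ultimately show ?thesis by (simp only: one_add_one)
  qed
  have "dim_vec (quad_forms \<alpha>1 \<alpha>2 \<alpha>3) = n + 1" "quad_forms \<alpha>1 \<alpha>2 \<alpha>3 $ 0 \<noteq> 0"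
    using assms by (simp_all add: quad_forms_def factor_indices_def variable_nonzero)
  then show "quad_forms \<alpha>1 \<alpha>2 \<alpha>3 \<in> form_tuples_deg n 2" "quad_forms \<alpha>1 \<alpha>2 \<alpha>3 \<in> form_tuples n"
    using form form_tuplesI[of _ n 2 0] by simp_all
qed

lemma subst_quad_forms:
  assumes "k < 3 + (\<alpha>1 + \<alpha>2 + \<alpha>3)"
  shows "subst_tuple (quad_forms \<alpha>1 \<alpha>2 \<alpha>3) (quad_forms \<alpha>1 \<alpha>2 \<alpha>3) $ k =
    (variable 0 * variable 1 * variable 2) * variable k"
proof -
  let ?A = "quad_forms \<alpha>1 \<alpha>2 \<alpha>3"
  have first: "?A $ 0 = variable 1 * variable 2" "?A $ 1 = variable 0 * variable 2"
    "?A $ 2 = variable 0 * variable 1"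
    by (simp_all add: quad_forms_def factor_indices_def)
  have rest: "?A $ k = variable (block \<alpha>1 \<alpha>2 k) * variable k" if "k \<ge> 3"
    using assms that by (simp add: quad_forms_def factor_indices_def)
  have index: "subst_tuple ?A ?A $ k = (case factor_indices \<alpha>1 \<alpha>2 k of (i, j) \<Rightarrow> ?A $ i * ?A $ j)"
    using assms by (simp add: subst_tuple_def quad_forms_def split_beta
        const_coeff.poly_value_mult const_coeff.poly_value_variable)
  have "k = 0 \<or> k = 1 \<or> k = 2 \<or> k \<ge> 3" by linarith
  then consider "k = 0" | "k = 1" | "k = 2" | "k \<ge> 3" by blast
  then show ?thesis
  proof cases
    case 4
    then have "factor_indices \<alpha>1 \<alpha>2 k = (block \<alpha>1 \<alpha>2 k, k)" by (simp add: factor_indices_def)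
    \<comment> \<open>With \<open>b = block \<alpha>1 \<alpha>2 k\<close>, the form
      \<open>A $ b\<close> is the product of the two other leading coordinates, and
      \<open>A $ k\<close> supplies \<open>variable b * variable k\<close>.\<close>
    then show ?thesis
      using block_cases[of \<alpha>1 \<alpha>2 k] by (auto simp: index rest[OF 4] first mult_ac simp del: One_nat_def)
  qed (use index in \<open>simp_all add: factor_indices_def first mult_ac del: One_nat_def\<close>)
qed

text \<open>The first three components already suffice: a common divisor has a single monomial
  dividing all three, and no variable occurs in all three.\<close>

lemma no_common_factor_quad_forms: "no_common_factor N (quad_forms \<alpha>1 \<alpha>2 \<alpha>3)"
  unfolding no_common_factor_def
proof (intro ballI impI)
  fix h assume "\<forall>k < dim_vec (quad_forms \<alpha>1 \<alpha>2 \<alpha>3). h dvd quad_forms \<alpha>1 \<alpha>2 \<alpha>3 $ k"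
  then have dvd: "h dvd quad_forms \<alpha>1 \<alpha>2 \<alpha>3 $ k" if "k < 3" for k
    using that by (simp add: quad_forms_def)
  let ?e = "\<lambda>i j :: nat. Poly_Mapping.single i (1::nat) + Poly_Mapping.single j 1"
  have divisor: "\<exists>m m'. Poly_Mapping.keys h = {m} \<and> m + m' = ?e i j"
    if dvd: "h dvd variable i * variable j" for i j
  proof -
    obtain g where "h * g = variable i * variable j" using dvd by (metis dvdE)
    then have "h * g = Poly_Mapping.single (?e i j) 1" by (simp add: variable_def mult_single)
    then show ?thesis using divisor_of_single one_neq_zero by metis
  qed
  have "h dvd variable 1 * variable 2" "h dvd variable 0 * variable 2" "h dvd variable 0 * variable 1"
    using dvd[of 0] dvd[of 1] dvd[of 2] by (simp_all add: quad_forms_def factor_indices_def)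
  \<comment> \<open>The same \<open>m\<close> serves all three products, since it is the only
    element of the support of \<open>h\<close>.\<close>
  from this[THEN divisor] obtain m m0 m1 m2 where m: "Poly_Mapping.keys h = {m}"
      "m + m0 = ?e 1 2" "m + m1 = ?e 0 2" "m + m2 = ?e 0 1"
    by (metis singleton_inject)
  \<comment> \<open>Each variable has exponent 0 in at least one of the three products, and natural
    exponents summing to 0 vanish.\<close>
  have "Poly_Mapping.lookup m i = 0" for i
    using m(2-4)[THEN arg_cong, of "\<lambda>m. Poly_Mapping.lookup m i"]
    by (auto simp: lookup_add lookup_single when_def split: if_splits)
  then have "m = 0" by (intro poly_mapping_eqI) simp
  define c where "c = Poly_Mapping.lookup h 0"
  have "c \<noteq> 0" using m(1) \<open>m = 0\<close> by (simp add: c_def flip: in_keys_iff)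
  have "h = const_poly c"
    using poly_mapping_eq_sum_single[of h] m(1) \<open>m = 0\<close> by (simp add: const_poly_def c_def)
  then have "1 = h * const_poly (inverse c)"
    using \<open>c \<noteq> 0\<close> by (simp add: const_poly_def mult_single)
  then show "h dvd 1" by (rule dvdI)
qed

section \<open>The affine identity and the projective involution\<close>

lemma quad_map_quad_map_point:
  assumes "a1 \<in> carrier_vec \<alpha>1" "a2 \<in> carrier_vec \<alpha>2" "a3 \<in> carrier_vec \<alpha>3"
  shows "quad_map \<alpha>1 \<alpha>2 \<alpha>3 (quad_map \<alpha>1 \<alpha>2 \<alpha>3 (point x1 x2 x3 a1 a2 a3)) =
    (x1 * x2 * x3) \<cdot>\<^sub>v point x1 x2 x3 a1 a2 a3"
  using assms
  by (auto simp: quad_map_point index_point intro!: eq_vecI)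

theorem mainTheorem8:
  fixes \<alpha>1 \<alpha>2 \<alpha>3 :: nat
  shows "(\<forall>x1 x2 x3. \<forall>a1 \<in> carrier_vec \<alpha>1. \<forall>a2 \<in> carrier_vec \<alpha>2. \<forall>a3 \<in> carrier_vec \<alpha>3.
            quad_map \<alpha>1 \<alpha>2 \<alpha>3 (quad_map \<alpha>1 \<alpha>2 \<alpha>3 (point x1 x2 x3 a1 a2 a3))
              = (x1 * x2 * x3) \<cdot>\<^sub>v point x1 x2 x3 a1 a2 a3)
       \<and> (let n = 2 + (\<alpha>1 + \<alpha>2 + \<alpha>3);
              f = projectivization n (quad_map \<alpha>1 \<alpha>2 \<alpha>3)
          in cremona n f \<and> involutive_map n f \<and> has_bidegree n f 2 2)"
proof -
  define n where "n = 2 + (\<alpha>1 + \<alpha>2 + \<alpha>3)"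
  let ?A = "quad_forms \<alpha>1 \<alpha>2 \<alpha>3"
  define f where "f = projectivization n (quad_map \<alpha>1 \<alpha>2 \<alpha>3)"
  note A = quad_forms_form_tuples[OF n_def]
  have f: "f = same_map n `` {?A}"
    unfolding f_def using A(2) eval_quad_forms by (rule projectivization_eq)
  have "compose_map n f f = id_map n"
    unfolding f
  proof (rule compose_map_self[OF A(2)])
    show "variable 0 * variable 1 * variable 2 \<noteq> 0" by (simp add: variable_nonzero)
  qed (simp add: subst_quad_forms n_def)
  moreover have "f \<in> rational_maps n"
    unfolding f rational_maps_def using A(2) by (rule quotientI)
  moreover have "given_by_coprime_forms n 2 f"
    unfolding given_by_coprime_forms_def f
    using A no_common_factor_quad_forms by (auto simp: same_map_def)
  \<comment> \<open>The map is its own inverse, so the same coprime quadratic forms give both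
    entries of the bidegree.\<close>
  ultimately have "cremona n f \<and> involutive_map n f \<and> has_bidegree n f 2 2"
    by (auto simp: cremona_def involutive_map_def has_bidegree_def mutually_inverse_def)
  then show ?thesis
    using quad_map_quad_map_point unfolding Let_def f_def n_def by blast
qed

end
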